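(* Let $K$ be a compact metric space with $\dim_t K>0$. Then for the generic $f\in C(K)$ $$\sup\left\{\dim_H f^{-1}(y): y\in\mathbb{R}\right\}=\dim_{tH}K-1.$$
   Context: $C(K)$ is the space of continuous functions $f\colon K\to\mathbb{R}$ with the supremum metric (a complete metric space). "For the generic $f\in C(K)$, property $\mathcal P$ holds" means that $\{f\in C(K): f\text{ has }\mathcal P\}$ is co-meager in $C(K)$ (its complement is a countable union of nowhere dense sets). $\dim_H$ denotes Hausdorff dimension, with the convention $\dim_H\emptyset=-1$. $\dim_t$ denotes the (small inductive) topological dimension: $\dim_t\emptyset=-1$ and, for non-empty $X$, inductively $\dim_t X=\inf\{d: X \text{ has a basis } \mathcal U \text{ with } \dim_t\partial U\le d-1 \text{ for every } U\in\mathcal U\}$. The topological Hausdorff dimension is defined by $\dim_{tH}\emptyset=-1$ and, for a non-empty metric space $X$, $\dim_{tH}X=\inf\{d: X \text{ has a basis } \mathcal U \text{ of open sets such that } \dim_H\partial U\le d-1 \text{ for every } U\in\mathcal U\}$. All these can take the value $\infty$ ($d=\infty$ is allowed), with the convention $\infty-1=\infty$. *)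

theory Defs
  imports "HOL-Analysis.Analysis"
begin

section \<open>Hausdorff dimension\<close>

text \<open>
  The term \<open>(diam U)\<^sup>s\<close> in the definition of Hausdorff measure, with the usual conventions
  \<open>(diam {})\<^sup>s = 0\<close> and \<open>(diam U)\<^sup>0 = 1\<close> for nonempty \<open>U\<close> (whereas \<open>0 powr 0 = 0\<close> in HOL).
\<close>
definition diam_pow :: "real \<Rightarrow> 'a::metric_space set \<Rightarrow> ennreal" where
  "diam_pow s U = (if U = {} then 0 else if s = 0 then 1 else ennreal (diameter U powr s))"

text \<open>Boundedness is required explicitly because \<^const>\<open>diameter\<close> is unspecified on unbounded sets.\<close>
definition hausdorff_pre_measure :: "real \<Rightarrow> real \<Rightarrow> 'a::metric_space set \<Rightarrow> ennreal" where
  "hausdorff_pre_measure s \<delta> A =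
     Inf {(\<Sum>i. diam_pow s (U i)) | U :: nat \<Rightarrow> 'a set.
            A \<subseteq> (\<Union>i. U i) \<and> (\<forall>i. bounded (U i) \<and> diameter (U i) \<le> \<delta>)}"

text \<open>The limit as \<open>\<delta>\<close> tends to \<open>0\<close> from the right is a supremum, by monotonicity in \<open>\<delta>\<close>.\<close>
definition hausdorff_measure :: "real \<Rightarrow> 'a::metric_space set \<Rightarrow> ennreal" where
  "hausdorff_measure s A = (SUP \<delta>\<in>{0<..}. hausdorff_pre_measure s \<delta> A)"

definition hausdorff_dim :: "'a::metric_space set \<Rightarrow> ereal" where
  "hausdorff_dim A =
     (if A = {} then -1 else Inf {ereal s | s. 0 \<le> s \<and> hausdorff_measure s A = 0})"


section \<open>Topological dimension and topological Hausdorff dimension\<close>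

definition topology_basis_of :: "'a topology \<Rightarrow> 'a set set \<Rightarrow> bool" where
  "topology_basis_of X \<B> \<longleftrightarrow> openin X = arbitrary union_of (\<lambda>U. U \<in> \<B>)"

text \<open>
  Based on the library's small inductive dimension relation \<^const>\<open>dimension_le\<close>; the value is
  \<open>\<infinity>\<close> if the relation holds for no integer. The recursive characterisation by bases is
  \<open>top_dim_rec\<close> below.
\<close>
definition top_dim :: "'a topology \<Rightarrow> ereal" where
  "top_dim X = Inf {ereal (of_int n) | n. X dim_le n}"

text \<open>
  Boundaries are taken in the subspace \<open>K\<close>. In \<^typ>\<open>ereal\<close>, \<open>\<infinity> - 1 = \<infinity>\<close>; and since
  \<open>hausdorff_dim\<close> is at least \<open>-1\<close>, no negative \<open>d\<close> contributes to the infimum.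
\<close>
definition top_hausdorff_dim :: "'a::metric_space set \<Rightarrow> ereal" where
  "top_hausdorff_dim K =
     (if K = {} then -1
      else Inf {d. \<exists>\<B>. topology_basis_of (top_of_set K) \<B> \<and>
                       (\<forall>U\<in>\<B>. hausdorff_dim (top_of_set K frontier_of U) \<le> d - 1)})"

lemma top_dim_le_iff: "top_dim X \<le> ereal r \<longleftrightarrow> X dim_le \<lfloor>r\<rfloor>"
proof
  assume "top_dim X \<le> ereal r"
  also have "ereal r < ereal (of_int (\<lfloor>r\<rfloor> + 1))"
    by simp
  finally obtain n where n: "X dim_le n" "ereal (of_int n) < ereal (of_int (\<lfloor>r\<rfloor> + 1))"
    unfolding top_dim_def Inf_less_iff by blast
  then have "n \<le> \<lfloor>r\<rfloor>"
    by simp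
  with n(1) show "X dim_le \<lfloor>r\<rfloor>"
    using dimension_le_mono by blast
next
  assume "X dim_le \<lfloor>r\<rfloor>"
  then have "top_dim X \<le> ereal (of_int \<lfloor>r\<rfloor>)"
    unfolding top_dim_def by (intro Inf_lower) blast
  also have "\<dots> \<le> ereal r"
    by simp
  finally show "top_dim X \<le> ereal r" .
qed

lemma top_dim_ge: "-1 \<le> top_dim X"
  unfolding top_dim_def
proof (intro Inf_greatest)
  fix d assume "d \<in> {ereal (of_int n) | n. X dim_le n}"
  then obtain n where "d = ereal (of_int n)" "-1 \<le> n"
    using dimension_le_bound by blast
  then have "ereal (-1) \<le> d"
    by simp
  then show "-1 \<le> d"
    by (simp add: one_ereal_def)
qed

lemma topology_basis_of_iff:
  "topology_basis_of X \<B> \<longleftrightarrow>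
     (\<forall>V\<in>\<B>. openin X V) \<and> (\<forall>U x. openin X U \<and> x \<in> U \<longrightarrow> (\<exists>V\<in>\<B>. x \<in> V \<and> V \<subseteq> U))"
  unfolding topology_basis_of_def openin_topology_base_unique by blast

lemma dim_le_unfold:
  "X dim_le n \<longleftrightarrow> -1 \<le> n \<and> (\<forall>V a. openin X V \<and> a \<in> V \<longrightarrow>
     (\<exists>U. a \<in> U \<and> U \<subseteq> V \<and> openin X U \<and> subtopology X (X frontier_of U) dim_le (n - 1)))"
  by (rule trans[OF dimension_le.simps]) auto

lemma dim_le_iff_basis:
  assumes "topspace X \<noteq> {}"
  shows "X dim_le n \<longleftrightarrow>
    (\<exists>\<B>. topology_basis_of X \<B> \<and> (\<forall>U\<in>\<B>. subtopology X (X frontier_of U) dim_le (n - 1)))"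
proof
  assume "X dim_le n"
  then have "topology_basis_of X {U. openin X U \<and> subtopology X (X frontier_of U) dim_le (n - 1)}"
    unfolding topology_basis_of_iff dim_le_unfold[of X n] by simp blast
  then show "\<exists>\<B>. topology_basis_of X \<B> \<and>
      (\<forall>U\<in>\<B>. subtopology X (X frontier_of U) dim_le (n - 1))"
    by blast
next
  assume "\<exists>\<B>. topology_basis_of X \<B> \<and>
      (\<forall>U\<in>\<B>. subtopology X (X frontier_of U) dim_le (n - 1))"
  then obtain \<B> where \<B>: "topology_basis_of X \<B>"
    "\<And>U. U \<in> \<B> \<Longrightarrow> subtopology X (X frontier_of U) dim_le (n - 1)"
    by blast
  obtain U where "U \<in> \<B>"
    using \<B>(1) assms unfolding topology_basis_of_iff by blast
  then have "-1 \<le> n"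
    using \<B>(2) dimension_le_bound by fastforce
  then show "X dim_le n"
    using \<B> unfolding topology_basis_of_iff dim_le_unfold[of X n] by meson
qed

lemma top_dim_rec:
  "top_dim X =
     (if topspace X = {} then -1
      else Inf {d. \<exists>\<B>. topology_basis_of X \<B> \<and>
                       (\<forall>U\<in>\<B>. top_dim (subtopology X (X frontier_of U)) \<le> d - 1)})"
proof (cases "topspace X = {}")
  case True
  then have "X dim_le (-1)"
    unfolding dim_le_unfold[of X "-1"] using openin_subset by fastforce
  then have "top_dim X \<le> ereal (of_int (-1))"
    unfolding top_dim_def by (intro Inf_lower) blast
  with True top_dim_ge[of X] show ?thesis
    by (simp add: one_ereal_def)
next
  case False
  define D where "D = {d. \<exists>\<B>. topology_basis_of X \<B> \<and>
                       (\<forall>U\<in>\<B>. top_dim (subtopology X (X frontier_of U)) \<le> d - 1)}"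
  have D_real: "ereal r \<in> D \<longleftrightarrow> X dim_le \<lfloor>r\<rfloor>" for r
  proof -
    have *: "ereal r - 1 = ereal (r - 1)"
      by (simp add: one_ereal_def)
    show ?thesis
      unfolding D_def mem_Collect_eq * top_dim_le_iff dim_le_iff_basis[OF False] by simp
  qed
  have "-\<infinity> \<notin> D"
  proof
    assume "-\<infinity> \<in> D"
    then obtain \<B> where \<B>: "topology_basis_of X \<B>"
      "\<And>U. U \<in> \<B> \<Longrightarrow> top_dim (subtopology X (X frontier_of U)) \<le> -\<infinity> - 1"
      unfolding D_def by blast
    obtain U where "U \<in> \<B>"
      using \<B>(1) False unfolding topology_basis_of_iff by blast
    then show False
      using \<B>(2)[of U] top_dim_ge[of "subtopology X (X frontier_of U)"]
      by (simp add: one_ereal_def)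
  qed
  then have "top_dim X \<le> d" if "d \<in> D" for d
    using that by (cases d) (auto simp: D_real top_dim_le_iff)
  moreover have "Inf D \<le> top_dim X"
    unfolding top_dim_def
    by (rule Inf_mono) (use D_real in fastforce)
  ultimately have "top_dim X = Inf D"
    by (intro antisym Inf_greatest)
  with False show ?thesis
    by (simp add: D_def)
qed


section \<open>Genericity\<close>

definition nowhere_dense_in :: "'a topology \<Rightarrow> 'a set \<Rightarrow> bool" where
  "nowhere_dense_in X S \<longleftrightarrow> S \<subseteq> topspace X \<and> X interior_of (X closure_of S) = {}"

definition meager_in :: "'a topology \<Rightarrow> 'a set \<Rightarrow> bool" where
  "meager_in X S \<longleftrightarrow> (\<exists>\<N>. countable \<N> \<and> (\<forall>N\<in>\<N>. nowhere_dense_in X N) \<and> S = \<Union>\<N>)"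

definition comeager_in :: "'a topology \<Rightarrow> 'a set \<Rightarrow> bool" where
  "comeager_in X S \<longleftrightarrow> S \<subseteq> topspace X \<and> meager_in X (topspace X - S)"

text \<open>
  \<open>C(K)\<close> with the supremum metric: for compact \<open>K\<close> the boundedness condition built into
  \<^const>\<open>cfunspace\<close> is automatic. Its elements are extensional functions, i.e. they take a fixed
  dummy value outside \<open>K\<close>, so level sets must be intersected with \<open>K\<close>.
\<close>
abbreviation C_space :: "'a::metric_space set \<Rightarrow> ('a \<Rightarrow> real) metric" where
  "C_space K \<equiv> cfunspace (top_of_set K) euclidean_metric"

definition generic_in_C :: "'a::metric_space set \<Rightarrow> (('a \<Rightarrow> real) \<Rightarrow> bool) \<Rightarrow> bool" where
  "generic_in_C K P \<longleftrightarrow> comeager_in (mtopology_of (C_space K)) {f \<in> mspace (C_space K). P f}"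

end

theory Submission
  imports Defs
begin

text \<open>
  Upper bound: if \<open>s > dim\<^sub>t\<^sub>H K - 1\<close>, then \<open>K\<close> has finite covers by small open sets whose boundaries
  have zero \<open>s\<close>-dimensional content. Any \<open>f\<close> can be perturbed so that every fibre of every nearby
  function lies in a neighbourhood of these boundaries together with one small cell of the cover, hence
  has small content. Intersecting over all scales gives \<open>dim\<^sub>H f\<^sup>-\<^sup>1(y) \<le> s\<close> for all \<open>y\<close>.

  Lower bound: if \<open>d < dim\<^sub>t\<^sub>H K\<close>, then some point \<open>x\<close> has a neighbourhood \<open>U\<close> in which every
  neighbourhood of \<open>x\<close> has boundary of dimension greater than \<open>d - 1\<close>. Adding a small bump at \<open>x\<close> to
  \<open>f\<close> makes a sublevel set of every nearby function a neighbourhood of \<open>x\<close> inside \<open>U\<close> whose boundary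
  is contained in a single fibre.
\<close>

section \<open>Hausdorff content\<close>

text \<open>With no bound on the diameters, a single infimum replaces a limit over scales, so
  smallness is witnessed by one cover and survives small perturbations. For \<open>s > 0\<close> it
  has the same null sets as \<open>hausdorff_measure s\<close>.\<close>

definition hausdorff_content :: "real \<Rightarrow> 'a::metric_space set \<Rightarrow> ennreal" where
  "hausdorff_content s A =
     Inf {(\<Sum>i. diam_pow s (U i)) | U :: nat \<Rightarrow> 'a set. A \<subseteq> (\<Union>i. U i) \<and> (\<forall>i. bounded (U i))}"

lemma diam_pow_empty [simp]: "diam_pow s {} = 0"
  by (simp add: diam_pow_def)

lemma hausdorff_content_le:
  "A \<subseteq> (\<Union>i. U i) \<Longrightarrow> (\<And>i. bounded (U i)) \<Longrightarrow> hausdorff_content s A \<le> (\<Sum>i. diam_pow s (U i))"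
  unfolding hausdorff_content_def by (rule Inf_lower) blast

lemma hausdorff_content_lessE:
  assumes "hausdorff_content s A < c"
  obtains U :: "nat \<Rightarrow> 'a::metric_space set"
  where "A \<subseteq> (\<Union>i. U i)" "\<And>i. bounded (U i)" "(\<Sum>i. diam_pow s (U i)) < c"
  using assms unfolding hausdorff_content_def Inf_less_iff by blast

section \<open>Monotonicity and subadditivity of the content\<close>

lemma hausdorff_content_mono: "A \<subseteq> B \<Longrightarrow> hausdorff_content s A \<le> hausdorff_content s B"
  unfolding hausdorff_content_def by (rule Inf_superset_mono) blast

lemma hausdorff_content_le_diam_pow:
  assumes "bounded A"
  shows "hausdorff_content s A \<le> diam_pow s A"
proof -
  let ?U = "\<lambda>i::nat. if i = 0 then A else {}"
  have "hausdorff_content s A \<le> (\<Sum>i. diam_pow s (?U i))"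
    by (rule hausdorff_content_le) (use assms in \<open>auto split: if_splits\<close>)
  also have "\<dots> = (\<Sum>i\<in>{0}. diam_pow s (?U i))"
    by (rule suminf_finite) auto
  finally show ?thesis
    by simp
qed

lemma hausdorff_content_Un:
  "hausdorff_content s (A \<union> B) \<le> hausdorff_content s A + hausdorff_content s B"
proof (rule ennreal_le_epsilon)
  fix e :: real
  assume fin: "hausdorff_content s A + hausdorff_content s B < top" and e: "0 < e"
  have "\<exists>U. C \<subseteq> (\<Union>i. U i) \<and> (\<forall>i. bounded (U i)) \<and>
      (\<Sum>i. diam_pow s (U i)) < hausdorff_content s C + ennreal (e / 2)"
    if "hausdorff_content s C < top" for C :: "'a set"
  proof -
    have "hausdorff_content s C < hausdorff_content s C + ennreal (e / 2)"
      using that e by (simp add: ennreal_add_left_cancel_less[of _ 0, simplified])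
    then show ?thesis
      by (metis hausdorff_content_lessE)
  qed
  with fin obtain U V where
    U: "A \<subseteq> (\<Union>i. U i)" "\<And>i. bounded (U i)"
       "(\<Sum>i. diam_pow s (U i)) < hausdorff_content s A + ennreal (e / 2)" and
    V: "B \<subseteq> (\<Union>i. V i)" "\<And>i. bounded (V i)"
       "(\<Sum>i. diam_pow s (V i)) < hausdorff_content s B + ennreal (e / 2)"
    by (metis ennreal_add_less_top)
  \<comment> \<open>The two covers become rows 0 and 1 of a double array whose other rows are empty
    and cost nothing. Flattening by \<open>prod_decode\<close> turns the array into one sequence,
    whose sum is the sum of the two row sums.\<close>
  define C where "C = (\<lambda>(m::nat, n::nat). if m = 0 then U n else if m = 1 then V n else {})"
  have C: "bounded (C p)" for p
    by (auto simp: C_def U V split: prod.splits)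
  have "U n \<subseteq> (\<Union>i. C (prod_decode i))" "V n \<subseteq> (\<Union>i. C (prod_decode i))" for n
    using UN_upper[of "prod_encode (0, n)" UNIV "\<lambda>i. C (prod_decode i)"]
      UN_upper[of "prod_encode (1, n)" UNIV "\<lambda>i. C (prod_decode i)"]
    by (simp_all add: C_def)
  then have "(\<Union>n. U n) \<union> (\<Union>n. V n) \<subseteq> (\<Union>i. C (prod_decode i))"
    by (intro Un_least UN_least)
  with Un_mono[OF U(1) V(1)] have "A \<union> B \<subseteq> (\<Union>i. C (prod_decode i))"
    by (rule order_trans)
  then have "hausdorff_content s (A \<union> B) \<le> (\<Sum>i. diam_pow s (C (prod_decode i)))"
    using C by (intro hausdorff_content_le)
  also have "\<dots> = (\<Sum>m. \<Sum>n. diam_pow s (C (m, n)))"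
    by (rule suminf_ennreal_2dimen) simp
  also have "\<dots> = (\<Sum>m\<in>{0, 1}. \<Sum>n. diam_pow s (C (m, n)))"
    by (rule suminf_finite) (auto simp: C_def)
  also have "\<dots> = (\<Sum>n. diam_pow s (U n)) + (\<Sum>n. diam_pow s (V n))"
    by (simp add: C_def)
  also have "\<dots> \<le> (hausdorff_content s A + ennreal (e / 2)) + (hausdorff_content s B + ennreal (e / 2))"
    using U(3) V(3) by (intro add_mono) auto
  also have "\<dots> = hausdorff_content s A + hausdorff_content s B + (ennreal (e / 2) + ennreal (e / 2))"
    by (simp add: ac_simps)
  also have "ennreal (e / 2) + ennreal (e / 2) = ennreal e"
    using e by (simp flip: ennreal_plus)
  finally show "hausdorff_content s (A \<union> B) \<le> hausdorff_content s A + hausdorff_content s B + ennreal e" .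
qed

lemma hausdorff_content_Union_eq_0:
  assumes "finite \<A>" "\<And>A. A \<in> \<A> \<Longrightarrow> hausdorff_content s A = 0"
  shows "hausdorff_content s (\<Union>\<A>) = 0"
  using assms
proof (induction \<A>)
  case empty
  then show ?case
    using hausdorff_content_le_diam_pow[of "{}" s] by simp
next
  case (insert A \<A>)
  then show ?case
    using hausdorff_content_Un[of s A "\<Union>\<A>"] by simp
qed

text \<open>The open \<open>t\<close>-neighbourhood of \<open>A\<close> has diameter at most
  \<open>diameter A + 2 * t\<close>, and its power tends to that of \<open>A\<close> as
  \<open>t\<close> tends to 0. Here \<open>0 < s\<close> gives continuity of the power even at
  diameter 0.\<close>

lemma diam_pow_open_superset:
  fixes A :: "'a::metric_space set"
  assumes "0 < s" "0 < e" "bounded A"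
  obtains V where "A \<subseteq> V" "open V" "bounded V" "diam_pow s V \<le> diam_pow s A + ennreal e"
proof (cases "A = {}")
  case True
  show ?thesis
    by (rule that[of "{}"]) (use True in auto)
next
  case False
  let ?d = "diameter A"
  have d: "0 \<le> ?d"
    using assms by (simp add: diameter_ge_0)
  have "((\<lambda>t. (?d + 2 * t) powr s) \<longlongrightarrow> (?d + 2 * 0) powr s) (at_right 0)"
    using d \<open>0 < s\<close> by (intro tendsto_intros tendsto_powr2) (auto intro!: eventually_at_rightI[of 0 1])
  then have "\<forall>\<^sub>F t in at_right 0. (?d + 2 * t) powr s < ?d powr s + e"
    using \<open>0 < e\<close> by (intro order_tendstoD) auto
  moreover have "\<forall>\<^sub>F t in at_right 0. 0 < (t::real)"
    by (simp add: eventually_at_right_less)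
  ultimately obtain t where t: "0 < t" "(?d + 2 * t) powr s < ?d powr s + e"
    using eventually_happens[OF eventually_conj] trivial_limit_at_right_real by blast
  define V where "V = (\<Union>a\<in>A. ball a t)"
  have dist: "dist x y \<le> ?d + 2 * t" if xy: "x \<in> V" "y \<in> V" for x y
  proof -
    obtain a b where ab: "a \<in> A" "b \<in> A" "dist a x < t" "dist b y < t"
      using xy by (auto simp: V_def)
    have "dist a b \<le> ?d"
      using ab assms diameter_bounded_bound by blast
    moreover have "dist x y \<le> dist a x + dist a b + dist b y"
      by (metis add.commute add_left_mono dist_commute dist_triangle order_trans dist_triangle2)
    ultimately show ?thesis
      using ab by linarith
  qed
  have AV: "A \<subseteq> V" "open V"
    using t by (auto simp: V_def)
  have bV: "bounded V"
    by (rule bounded_two_points[THEN iffD2]) (use dist in blast)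
  have "diameter V \<le> ?d + 2 * t"
    unfolding diameter_def[of V] using dist AV(1) False by (auto intro!: cSUP_least)
  then have "diameter V powr s \<le> ?d powr s + e"
    using t assms diameter_ge_0[OF bV] powr_mono2[of s "diameter V" "?d + 2 * t"] by linarith
  then have "diam_pow s V \<le> ennreal (?d powr s + e)"
    unfolding diam_pow_def using assms by (auto simp del: ennreal_plus intro: ennreal_leI)
  also have "\<dots> = diam_pow s A + ennreal e"
    using False assms by (simp add: diam_pow_def)
  finally show ?thesis
    by (rule that[OF AV bV])
qed

text \<open>Each set of a cover witnessing the bound is enlarged to an open set, and the slack
  \<open>e\<close> is distributed over the cover as a geometric series.\<close>

lemma hausdorff_content_open_superset:
  fixes A :: "'a::metric_space set"
  assumes "0 < s" "hausdorff_content s A < c"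
  obtains W where "open W" "A \<subseteq> W" "hausdorff_content s W < c"
proof -
  obtain U :: "nat \<Rightarrow> 'a set" where U: "A \<subseteq> (\<Union>i. U i)" "\<And>i. bounded (U i)"
      "(\<Sum>i. diam_pow s (U i)) < c"
    using hausdorff_content_lessE[OF assms(2)] by blast
  obtain b where b: "(\<Sum>i. diam_pow s (U i)) < b" "b < c"
    using dense[OF U(3)] by blast
  \<comment> \<open>Since \<open>c\<close> may be infinite, the slack is measured against the finite
    intermediate value \<open>b\<close>; \<open>e\<close> is the difference between \<open>b\<close>
    and the sum.\<close>
  obtain e where e: "0 < e" "(\<Sum>i. diam_pow s (U i)) + ennreal e < c"
  proof -
    have "b < top"
      using b(2) by (meson less_le_trans top_greatest)
    then obtain r where r: "0 \<le> r" "b = ennreal r"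
      by (cases b) auto
    obtain q where q: "0 \<le> q" "(\<Sum>i. diam_pow s (U i)) = ennreal q"
      using b(1) \<open>b < top\<close> by (cases "\<Sum>i. diam_pow s (U i)") auto
    have "q < r"
      using b(1) q r by (simp add: ennreal_less_iff)
    then show ?thesis
      using that[of "r - q"] q r b(2) by (simp flip: ennreal_plus)
  qed
  have "\<exists>V. U i \<subseteq> V \<and> open V \<and> bounded V \<and>
      diam_pow s V \<le> diam_pow s (U i) + ennreal (e * (1 / 2) ^ Suc i)" for i
    by (rule diam_pow_open_superset[OF assms(1) _ U(2), of "e * (1 / 2) ^ Suc i" i])
      (use e in \<open>auto\<close>)
  then obtain V where V: "\<And>i. U i \<subseteq> V i" "\<And>i. open (V i)" "\<And>i. bounded (V i)"
      "\<And>i. diam_pow s (V i) \<le> diam_pow s (U i) + ennreal (e * (1 / 2) ^ Suc i)"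
    by metis
  have "hausdorff_content s (\<Union>i. V i) \<le> (\<Sum>i. diam_pow s (V i))"
    using V by (intro hausdorff_content_le) auto
  also have "\<dots> \<le> (\<Sum>i. diam_pow s (U i) + ennreal (e * (1 / 2) ^ Suc i))"
    using V by (intro suminf_le) auto
  also have "\<dots> = (\<Sum>i. diam_pow s (U i)) + (\<Sum>i. ennreal (e * (1 / 2) ^ Suc i))"
    by (rule suminf_add[symmetric]) auto
  also have "(\<Sum>i. ennreal (e * (1 / 2) ^ Suc i)) = ennreal e"
    using e sums_mult[OF power_half_series, of e] by (intro suminf_ennreal_eq) auto
  finally have "hausdorff_content s (\<Union>i. V i) < c"
    using e(2) by (rule le_less_trans)
  moreover have "open (\<Union>i. V i)"
    using V(2) by blast
  moreover have "A \<subseteq> (\<Union>i. V i)"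
    using U(1) UN_mono[OF order_refl V(1)] by (rule order_trans)
  ultimately show ?thesis
    using that by blast
qed

text \<open>For \<open>s > 0\<close> a cover with a small sum consists of sets of small diameter.\<close>
lemma hausdorff_measure_eq_0_if_content:
  fixes A :: "'a::metric_space set"
  assumes "0 < s" "hausdorff_content s A = 0"
  shows "hausdorff_measure s A = 0"
proof -
  have "hausdorff_pre_measure s \<delta> A = 0" if "0 < \<delta>" for \<delta>
  proof -
    have "hausdorff_pre_measure s \<delta> A \<le> 0 + ennreal e" if "0 < e" for e
    proof -
      define c where "c = min e (\<delta> powr s)"
      have "0 < c"
        using \<open>0 < e\<close> \<open>0 < \<delta>\<close> by (simp add: c_def)
      then have "hausdorff_content s A < ennreal c"
        using assms by simp
      then obtain U :: "nat \<Rightarrow> 'a set" where U: "A \<subseteq> (\<Union>i. U i)" "\<And>i. bounded (U i)"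
          "(\<Sum>i. diam_pow s (U i)) < ennreal c"
        using hausdorff_content_lessE by blast
      have "diameter (U i) \<le> \<delta>" for i
      proof (cases "U i = {}")
        case False
        have "diam_pow s (U i) < ennreal c"
          using U(3) by (rule ennreal_suminf_lessD)
        then have "diameter (U i) powr s < c"
          using False assms by (auto simp: diam_pow_def ennreal_less_iff)
        then have "diameter (U i) powr s < \<delta> powr s"
          by (simp add: c_def)
        then show ?thesis
          using powr_mono2[of s \<delta> "diameter (U i)"] assms \<open>0 < \<delta>\<close> by force
      qed (use \<open>0 < \<delta>\<close> in simp)
      then have "hausdorff_pre_measure s \<delta> A \<le> (\<Sum>i. diam_pow s (U i))"
        unfolding hausdorff_pre_measure_def using U by (intro Inf_lower) blast
      also have "\<dots> \<le> ennreal c"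
        using U(3) by simp
      also have "\<dots> \<le> ennreal e"
        by (simp add: c_def ennreal_leI)
      finally show ?thesis
        by simp
    qed
    then have "hausdorff_pre_measure s \<delta> A \<le> 0"
      by (rule ennreal_le_epsilon)
    then show ?thesis
      by simp
  qed
  then show ?thesis
    unfolding hausdorff_measure_def by (simp add: SUP_eq_const)
qed

text \<open>For sets of diameter at most 1, raising the exponent from \<open>t\<close> to
  \<open>s\<close> can only lower the cost, so covers admissible at scale 1 already give the
  bound.\<close>

lemma hausdorff_content_eq_0_if_measure:
  fixes A :: "'a::metric_space set"
  assumes "0 \<le> t" "t < s" "hausdorff_measure t A = 0"
  shows "hausdorff_content s A = 0"
proof -
  have "hausdorff_pre_measure t 1 A \<le> hausdorff_measure t A"
    unfolding hausdorff_measure_def by (rule SUP_upper) simp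
  moreover have "hausdorff_content s A \<le> hausdorff_pre_measure t 1 A"
    unfolding hausdorff_pre_measure_def
  proof (rule Inf_greatest, safe)
    fix U :: "nat \<Rightarrow> 'a set"
    assume U: "A \<subseteq> (\<Union>i. U i)" "\<forall>i. bounded (U i) \<and> diameter (U i) \<le> 1"
    \<comment> \<open>The case \<open>t = 0\<close> is separate because nonempty sets then cost 1 by
      convention; \<open>powr_le1\<close> settles it.\<close>
    have "diam_pow s (U i) \<le> diam_pow t (U i)" for i
      using assms U(2) diameter_ge_0[of "U i"] powr_mono'[of t s "diameter (U i)"]
        powr_le1[of s "diameter (U i)"]
      by (auto simp: diam_pow_def intro!: ennreal_leI)
    then have "(\<Sum>i. diam_pow s (U i)) \<le> (\<Sum>i. diam_pow t (U i))"
      by (intro suminf_le) auto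
    moreover have "hausdorff_content s A \<le> (\<Sum>i. diam_pow s (U i))"
      using U by (intro hausdorff_content_le) auto
    ultimately show "hausdorff_content s A \<le> (\<Sum>i. diam_pow t (U i))"
      by simp
  qed
  ultimately show ?thesis
    using assms(3) by simp
qed

section \<open>From null content to Hausdorff dimension and back\<close>

lemma hausdorff_dim_le_if_content:
  assumes "0 < s" "hausdorff_content s A = 0"
  shows "hausdorff_dim A \<le> ereal s"
proof -
  have "Inf {ereal t | t. 0 \<le> t \<and> hausdorff_measure t A = 0} \<le> ereal s"
    using hausdorff_measure_eq_0_if_content[OF assms] assms(1) by (intro Inf_lower) auto
  moreover have "(-1::ereal) \<le> ereal s"
    using assms(1) by (simp add: one_ereal_def)
  ultimately show ?thesis
    by (simp add: hausdorff_dim_def)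
qed

lemma hausdorff_content_eq_0_if_dim:
  assumes "0 < s" "hausdorff_dim A < ereal s"
  shows "hausdorff_content s A = 0"
proof (cases "A = {}")
  case True
  then show ?thesis
    using hausdorff_content_le_diam_pow[of A s] by simp
next
  case False
  with assms obtain t where "0 \<le> t" "t < s" "hausdorff_measure t A = 0"
    by (auto simp: hausdorff_dim_def Inf_less_iff)
  then show ?thesis
    by (rule hausdorff_content_eq_0_if_measure)
qed

lemma hausdorff_dim_nonneg: "A \<noteq> {} \<Longrightarrow> 0 \<le> hausdorff_dim A"
  by (auto simp: hausdorff_dim_def intro!: Inf_greatest)

lemma hausdorff_dim_ge: "-1 \<le> hausdorff_dim A"
  using order_trans[of "-1" 0 "hausdorff_dim A"] hausdorff_dim_nonneg[of A]
  by (cases "A = {}") (simp_all add: hausdorff_dim_def)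

lemma hausdorff_dim_mono:
  assumes "A \<subseteq> B"
  shows "hausdorff_dim A \<le> hausdorff_dim B"
proof (cases "A = {}")
  case True
  then show ?thesis
    using hausdorff_dim_ge[of B] by (simp add: hausdorff_dim_def)
next
  case False
  have "hausdorff_pre_measure s \<delta> A \<le> hausdorff_pre_measure s \<delta> B" for s \<delta>
    unfolding hausdorff_pre_measure_def using assms by (intro Inf_superset_mono) blast
  then have "hausdorff_measure s A \<le> hausdorff_measure s B" for s
    unfolding hausdorff_measure_def by (intro SUP_mono) blast
  then have "hausdorff_measure s A = 0" if "hausdorff_measure s B = 0" for s
    using that by (metis le_zero_eq)
  with False assms show ?thesis
    by (auto simp: hausdorff_dim_def intro!: Inf_superset_mono)
qed

section \<open>Generic continuous functions\<close>

text \<open>An interior point of the closure of \<open>S\<close> would have a whole ball in that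
  closure, but this ball contains a point \<open>y\<close> with a neighbourhood that misses
  \<open>S\<close>.\<close>

lemma nowhere_dense_in_mtopology_ofI:
  assumes "S \<subseteq> mspace M"
    and ball: "\<And>x r. x \<in> mspace M \<Longrightarrow> 0 < r \<Longrightarrow>
      \<exists>y\<in>mspace M. mdist M x y < r \<and> (\<exists>\<delta>>0. \<forall>z\<in>mspace M. mdist M y z < \<delta> \<longrightarrow> z \<notin> S)"
  shows "nowhere_dense_in (mtopology_of M) S"
proof -
  interpret M: Metric_space "mspace M" "mdist M"
    by (rule Metric_space_mspace_mdist)
  have top: "mtopology_of M = M.mtopology"
    by (simp add: mtopology_of_def)
  have "M.mtopology interior_of (M.mtopology closure_of S) = {}"
  proof (rule equals0I)
    fix x assume "x \<in> M.mtopology interior_of (M.mtopology closure_of S)"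
    moreover have "openin M.mtopology (M.mtopology interior_of (M.mtopology closure_of S))"
      by (rule openin_interior_of)
    ultimately obtain r where x: "x \<in> mspace M" "0 < r"
        "M.mball x r \<subseteq> M.mtopology interior_of (M.mtopology closure_of S)"
      unfolding M.openin_mtopology by blast
    note x(3)
    also have "M.mtopology interior_of (M.mtopology closure_of S) \<subseteq> M.mtopology closure_of S"
      by (rule interior_of_subset)
    finally have sub: "M.mball x r \<subseteq> M.mtopology closure_of S" .
    obtain y \<delta> where y: "y \<in> mspace M" "mdist M x y < r" "0 < \<delta>"
        "\<forall>z\<in>mspace M. mdist M y z < \<delta> \<longrightarrow> z \<notin> S"
      using ball[OF x(1,2)] by blast
    have "y \<in> M.mtopology closure_of S"
      using sub x(1) y(1,2) by (simp add: subset_iff)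
    then show False
      using y unfolding M.metric_closure_of by (auto simp: M.in_mball)
  qed
  then show ?thesis
    using assms(1) by (simp add: nowhere_dense_in_def top)
qed

text \<open>Perturbations are built as functions on the whole type, whereas members of
  \<open>C_space K\<close> are extensional. Compactness supplies the required boundedness.\<close>

lemma restrict_in_C_space:
  assumes "compact K" "continuous_on K g"
  shows "restrict g K \<in> mspace (C_space K)"
proof -
  have "bounded (restrict g K ` K)"
    using compact_continuous_image[OF assms(2,1)] compact_imp_bounded by simp
  moreover have "continuous_on K (restrict g K)"
    using assms(2) by (simp cong: continuous_on_cong)
  ultimately show ?thesis
    by simp
qed

text \<open>If each of countably many conditions \<open>Q i\<close> holds on a ball near every
  function, then all of them hold together off a meager set. Pointwise inequalities on
  \<open>K\<close> stand in for the supremum metric, so the perturbation lemmas need not mention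
  function spaces.\<close>

lemma generic_in_CI:
  fixes K :: "'a::metric_space set" and Q :: "'i::countable \<Rightarrow> ('a \<Rightarrow> real) \<Rightarrow> bool"
  assumes "compact K"
    and dense: "\<And>i f r. continuous_on K f \<Longrightarrow> 0 < r \<Longrightarrow>
      \<exists>g. continuous_on K g \<and> (\<forall>x\<in>K. \<bar>g x - f x\<bar> \<le> r) \<and>
        (\<exists>\<delta>>0. \<forall>h. continuous_on K h \<longrightarrow> (\<forall>x\<in>K. \<bar>h x - g x\<bar> < \<delta>) \<longrightarrow> Q i h)"
    and P: "\<And>f. continuous_on K f \<Longrightarrow> (\<And>i. Q i f) \<Longrightarrow> P f"
  shows "generic_in_C K P"
proof -
  \<comment> \<open>The conjunct \<open>\<not> P f\<close> makes the union of these sets equal to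
    the exceptional set, as \<open>meager_in\<close> demands equality and not just
    inclusion.\<close>
  define N where "N i = {f \<in> mspace (C_space K). \<not> P f \<and> \<not> Q i f}" for i
  have cont: "continuous_on K f" if "f \<in> mspace (C_space K)" for f
    using that by simp
  have N: "nowhere_dense_in (mtopology_of (C_space K)) (N i)" for i
  proof (rule nowhere_dense_in_mtopology_ofI)
    show "N i \<subseteq> mspace (C_space K)"
      unfolding N_def by blast
    fix f and r :: real
    assume f: "f \<in> mspace (C_space K)" and "0 < r"
    \<comment> \<open>Half the radius is used because \<open>dense\<close> gives a non-strict bound
      while the ball needs a strict one.\<close>
    then obtain g \<delta> where g: "continuous_on K g" "\<forall>x\<in>K. \<bar>g x - f x\<bar> \<le> r / 2" "0 < \<delta>"
        "\<And>h. continuous_on K h \<Longrightarrow> (\<forall>x\<in>K. \<bar>h x - g x\<bar> < \<delta>) \<Longrightarrow> Q i h"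
      using dense[of f "r / 2" i] cont half_gt_zero by blast
    let ?g = "restrict g K"
    have gC: "?g \<in> mspace (C_space K)"
      using assms(1) g(1) by (rule restrict_in_C_space)
    have "mdist (C_space K) f ?g \<le> r / 2"
      using g(2) \<open>0 < r\<close> by (intro mdist_cfunspace_le) (auto simp: dist_real_def abs_minus_commute)
    then have "mdist (C_space K) f ?g < r"
      using \<open>0 < r\<close> by linarith
    moreover have "z \<notin> N i" if z: "z \<in> mspace (C_space K)" "mdist (C_space K) ?g z < \<delta>" for z
    proof -
      have "mdist euclidean_metric (?g x) (z x) < \<delta>" if "x \<in> K" for x
        by (rule cfunspace_mdist_lt[OF _ gC z]) (use that assms(1) in \<open>auto simp: compactin_subtopology\<close>)
      then have "\<forall>x\<in>K. \<bar>z x - g x\<bar> < \<delta>"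
        by (auto simp: dist_real_def abs_minus_commute)
      then have "Q i z"
        using g(4) cont z(1) by blast
      then show ?thesis
        by (simp add: N_def)
    qed
    ultimately show "\<exists>y\<in>mspace (C_space K). mdist (C_space K) f y < r \<and>
        (\<exists>\<delta>>0. \<forall>z\<in>mspace (C_space K). mdist (C_space K) y z < \<delta> \<longrightarrow> z \<notin> N i)"
      using gC \<open>0 < \<delta>\<close> by blast
  qed
  have "mspace (C_space K) - {f \<in> mspace (C_space K). P f} = \<Union>(range N)"
    unfolding N_def using P cont by blast
  then have "meager_in (mtopology_of (C_space K))
      (mspace (C_space K) - {f \<in> mspace (C_space K). P f})"
    unfolding meager_in_def using N by (intro exI[of _ "range N"]) auto
  then show ?thesis
    unfolding generic_in_C_def comeager_in_def by (simp del: mspace_cfunspace)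
qed

lemma normal_space_top_of_set: "normal_space (top_of_set (K :: 'a::metric_space set))"
  by (simp add: metrizable_imp_normal_space metrizable_space_subtopology metrizable_space_euclidean)

section \<open>Large fibres\<close>

text \<open>If there were no such point, the open sets with boundary of dimension at most
  \<open>d - 1\<close> would form a basis, forcing
  \<open>top_hausdorff_dim K \<le> d\<close>.\<close>

lemma bad_point:
  assumes "ereal d < top_hausdorff_dim K" "K \<noteq> {}"
  obtains x U where "openin (top_of_set K) U" "x \<in> U"
    "\<forall>V. openin (top_of_set K) V \<and> x \<in> V \<and> V \<subseteq> U \<longrightarrow>
      ereal (d - 1) < hausdorff_dim (top_of_set K frontier_of V)"
proof (rule ccontr)
  let ?\<B> = "{V. openin (top_of_set K) V \<and> hausdorff_dim (top_of_set K frontier_of V) \<le> ereal (d - 1)}"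
  assume "\<not> thesis"
  with that have "\<exists>V. openin (top_of_set K) V \<and> x \<in> V \<and> V \<subseteq> U \<and>
      hausdorff_dim (top_of_set K frontier_of V) \<le> ereal (d - 1)"
    if "openin (top_of_set K) U" "x \<in> U" for x U
    using that by (meson not_le)
  then have "topology_basis_of (top_of_set K) ?\<B>"
    unfolding topology_basis_of_iff by simp meson
  then have "top_hausdorff_dim K \<le> ereal d"
    unfolding top_hausdorff_dim_def using assms(2)
    by (auto simp: one_ereal_def intro!: Inf_lower exI[of _ ?\<B>])
  with assms(1) show False
    by simp
qed

text \<open>Raising \<open>f\<close> by \<open>r / 2\<close> away from a bad point \<open>x\<close>
  creates a well around \<open>x\<close>. Every nearby \<open>h\<close> has a sublevel set inside
  the well that is a neighbourhood of \<open>x\<close>, and its boundary, which is large by the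
  choice of \<open>x\<close>, lies in one fibre of \<open>h\<close>.\<close>

lemma large_fibre_perturbation:
  fixes K :: "'a::metric_space set" and f :: "'a \<Rightarrow> real"
  assumes "ereal d < top_hausdorff_dim K" "K \<noteq> {}" "continuous_on K f" "0 < r"
  shows "\<exists>g. continuous_on K g \<and> (\<forall>x\<in>K. \<bar>g x - f x\<bar> \<le> r) \<and>
    (\<exists>\<delta>>0. \<forall>h. continuous_on K h \<longrightarrow> (\<forall>x\<in>K. \<bar>h x - g x\<bar> < \<delta>) \<longrightarrow>
      (\<exists>y. ereal (d - 1) < hausdorff_dim {x \<in> K. h x = y}))"
proof -
  let ?X = "top_of_set K"
  obtain x U where x: "openin ?X U" "x \<in> U" and
    bad: "\<forall>V. openin ?X V \<and> x \<in> V \<and> V \<subseteq> U \<longrightarrow>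
      ereal (d - 1) < hausdorff_dim (?X frontier_of V)"
    by (rule bad_point[OF assms(1,2)])
  define U' where "U' = {z \<in> U. \<bar>f z - f x\<bar> < r / 8}"
  have U': "openin ?X U'" "x \<in> U'" "U' \<subseteq> U"
  proof -
    have "U' = U \<inter> (K \<inter> f -` ball (f x) (r / 8))"
      using openin_subset[OF x(1)] by (auto simp: U'_def dist_real_def abs_minus_commute)
    then show "openin ?X U'"
      using x(1) assms(3) by (simp add: continuous_openin_preimage_gen openin_Int)
  qed (use x assms in \<open>auto simp: U'_def\<close>)
  have "x \<in> K"
    using x openin_subset by fastforce
  have "closedin ?X {x}"
    using \<open>x \<in> K\<close> by (intro closed_subset) auto
  moreover have "closedin ?X (K - U')"
    using U'(1) closedin_diff[OF closedin_topspace] by fastforce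
  moreover have "disjnt {x} (K - U')"
    using U'(2) by (simp add: disjnt_def)
  ultimately obtain b where b: "continuous_map ?X (top_of_set {0..1::real}) b" "b ` {x} \<subseteq> {0}"
      "b ` (K - U') \<subseteq> {1}"
    by (rule Urysohn_lemma[OF normal_space_top_of_set _ _ _ zero_le_one])
  have bc: "continuous_on K b" and b01: "\<And>z. z \<in> K \<Longrightarrow> 0 \<le> b z \<and> b z \<le> 1"
    using b(1) by (auto simp: continuous_map_in_subtopology)
  define g where "g z = f z + r / 2 * b z" for z
  \<comment> \<open>With errors of \<open>r / 8\<close> from the oscillation of \<open>f\<close> and
    from \<open>h\<close>, the level \<open>c\<close> lies above \<open>h x\<close>, which is below
    \<open>f x + r / 8\<close>. Outside \<open>U'\<close>, wherever \<open>f\<close> is within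
    \<open>r / 8\<close> of \<open>f x\<close>, \<open>h\<close> exceeds
    \<open>f x - r / 8 + r / 2 - r / 8 = c\<close>.\<close>
  define c where "c = f x + r / 4"
  have "continuous_on K g"
    unfolding g_def using assms(3) bc by (intro continuous_intros)
  moreover have "\<bar>g z - f z\<bar> \<le> r" if "z \<in> K" for z
    using b01[OF that] \<open>0 < r\<close> mult_left_le[of "b z" "r / 2"] by (simp add: g_def)
  moreover have "\<exists>y. ereal (d - 1) < hausdorff_dim {x \<in> K. h x = y}"
    if h: "continuous_on K h" "\<And>z. z \<in> K \<Longrightarrow> \<bar>h z - g z\<bar> < r / 8" for h
  proof -
    define W where "W = {z \<in> U'. h z < c}"
    have W: "openin ?X W"
    proof -
      have "W = U' \<inter> (K \<inter> h -` {..<c})"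
        using openin_subset[OF U'(1)] by (auto simp: W_def)
      then show ?thesis
        using U'(1) h(1) by (simp add: continuous_openin_preimage_gen openin_Int)
    qed
    have "g x = f x"
      using b(2) by (simp add: g_def)
    then have "h x < c"
      using h(2)[OF \<open>x \<in> K\<close>] \<open>0 < r\<close> unfolding c_def by linarith
    then have "x \<in> W"
      using U'(2) by (simp add: W_def)
    have "?X frontier_of W \<subseteq> {z \<in> K. h z = c}"
    proof
      fix z assume z: "z \<in> ?X frontier_of W"
      then have zK: "z \<in> K" and zW: "z \<notin> W" and zcl: "z \<in> ?X closure_of W"
        using W frontier_of_subset_topspace[of ?X W] by (auto simp: frontier_of_def interior_of_openin)
      \<comment> \<open>Non-strict bounds on \<open>h\<close> and \<open>f\<close> pass from
        \<open>W\<close> to its closure. The bound on \<open>f\<close> thus holds even at a boundary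
        point outside \<open>U'\<close>, which is what rules out such a point.\<close>
      have "closedin ?X (K \<inter> h -` {..c} \<inter> (K \<inter> f -` cball (f x) (r / 8)))"
        using h(1) assms(3) by (intro closedin_Int continuous_closedin_preimage) auto
      moreover have "W \<subseteq> K \<inter> h -` {..c} \<inter> (K \<inter> f -` cball (f x) (r / 8))"
        using openin_subset[OF W] by (auto simp: W_def U'_def dist_real_def abs_minus_commute)
      ultimately have "?X closure_of W \<subseteq> K \<inter> h -` {..c} \<inter> (K \<inter> f -` cball (f x) (r / 8))"
        by (intro closure_of_minimal)
      then have le: "h z \<le> c" "\<bar>f z - f x\<bar> \<le> r / 8"
        using zcl by (auto simp: dist_real_def abs_minus_commute)
      have "z \<in> U'"
      proof (rule ccontr)
        assume "z \<notin> U'"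
        then have "g z = f z + r / 2"
          using b(3) zK by (auto simp: g_def)
        then show False
          using h(2)[OF zK] le unfolding c_def by linarith
      qed
      then show "z \<in> {z \<in> K. h z = c}"
        using zW le(1) zK by (simp add: W_def)
    qed
    then have "hausdorff_dim (?X frontier_of W) \<le> hausdorff_dim {z \<in> K. h z = c}"
      by (rule hausdorff_dim_mono)
    moreover have "W \<subseteq> U"
      using U'(3) by (auto simp: W_def)
    ultimately show ?thesis
      using bad W \<open>x \<in> W\<close> by (meson less_le_trans)
  qed
  ultimately show ?thesis
    using \<open>0 < r\<close> by (intro exI[of _ g] conjI exI[of _ "r / 8"]) auto
qed

section \<open>Small fibres\<close>

text \<open>No set has Hausdorff dimension strictly between -1 and 0, so a bound
  \<open>d < 1\<close> would make all boundaries in some basis empty and \<open>K\<close>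
  zero-dimensional.\<close>

lemma one_le_top_hausdorff_dim:
  fixes K :: "'a::metric_space set"
  assumes "0 < top_dim (top_of_set K)" "K \<noteq> {}"
  shows "1 \<le> top_hausdorff_dim K"
proof (rule ccontr)
  let ?X = "top_of_set K"
  assume "\<not> 1 \<le> top_hausdorff_dim K"
  then obtain d \<B> where d: "d < 1" and \<B>: "topology_basis_of ?X \<B>"
      "\<And>U. U \<in> \<B> \<Longrightarrow> hausdorff_dim (?X frontier_of U) \<le> d - 1"
    using assms(2) by (auto simp: top_hausdorff_dim_def not_le Inf_less_iff)
  have "d - 1 < 0"
    using d by (cases d) (auto simp: one_ereal_def)
  then have "?X frontier_of U = {}" if "U \<in> \<B>" for U
    using \<B>(2)[OF that] hausdorff_dim_nonneg[of "?X frontier_of U"] by force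
  moreover have "trivial_topology dim_le (-1 :: int)"
    unfolding dim_le_unfold[of _ "-1"] by simp
  ultimately have "?X dim_le 0"
    using \<B>(1) assms(2) by (subst dim_le_iff_basis) (auto intro!: exI[of _ \<B>])
  then have "top_dim ?X \<le> ereal 0"
    by (simp add: top_dim_le_iff)
  with assms(1) show False
    by (metis not_le zero_ereal_def)
qed

text \<open>Some basis has boundaries of dimension below \<open>s\<close>, hence of null content.
  The neighbourhood is given as the trace of an ambient open set \<open>T\<close>, ready for
  compactness and closedness arguments in the whole space.\<close>

lemma null_frontier_nbhd:
  fixes K :: "'a::metric_space set"
  assumes "top_hausdorff_dim K < ereal (s + 1)" "0 < s" "open U" "x \<in> K" "x \<in> U"
  shows "\<exists>T. open T \<and> x \<in> T \<and> K \<inter> T \<subseteq> U \<and>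
    hausdorff_content s (top_of_set K frontier_of (K \<inter> T)) = 0"
proof -
  let ?X = "top_of_set K"
  have "K \<noteq> {}"
    using assms(4) by blast
  with assms(1) obtain d \<B> where d: "d < ereal (s + 1)" and \<B>: "topology_basis_of ?X \<B>"
      "\<And>U. U \<in> \<B> \<Longrightarrow> hausdorff_dim (?X frontier_of U) \<le> d - 1"
    by (auto simp: top_hausdorff_dim_def Inf_less_iff)
  have "openin ?X (K \<inter> U)" "x \<in> K \<inter> U"
    using assms by auto
  then obtain V where V: "V \<in> \<B>" "openin ?X V" "x \<in> V" "V \<subseteq> K \<inter> U"
    using \<B>(1) unfolding topology_basis_of_iff by meson
  have "d - 1 < ereal s"
    using d by (cases d) (auto simp: one_ereal_def)
  with \<B>(2)[OF V(1)] have "hausdorff_content s (?X frontier_of V) = 0"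
    by (intro hausdorff_content_eq_0_if_dim assms) simp
  moreover obtain T where "open T" "V = K \<inter> T"
    using V(2) by (meson openin_open)
  ultimately show ?thesis
    using V(3,4) by (intro exI[of _ T]) auto
qed

text \<open>Each interval around \<open>v i\<close> is infinite, so it has a value not yet taken.
  This separates cells on which \<open>f\<close> has nearly equal values.\<close>

lemma finite_distinct_approximations:
  fixes v :: "'i \<Rightarrow> real"
  assumes "finite I" "0 < r"
  shows "\<exists>c. inj_on c I \<and> (\<forall>i\<in>I. \<bar>c i - v i\<bar> < r)"
  using assms(1)
proof (induction I)
  case (insert i I)
  then obtain c where c: "inj_on c I" "\<forall>i\<in>I. \<bar>c i - v i\<bar> < r"
    by blast
  have "infinite {v i - r<..<v i + r}"
    using assms(2) by (simp add: infinite_Ioo)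
  then have "infinite ({v i - r<..<v i + r} - c ` I)"
    using insert by (intro Diff_infinite_finite) auto
  then obtain t where t: "t \<in> {v i - r<..<v i + r}" "t \<notin> c ` I"
    by (metis DiffE finite.emptyI ex_in_conv)
  have "inj_on (c(i := t)) (insert i I)"
    using c(1) t(2) insert(2) by (auto simp: inj_on_def)
  moreover have "\<forall>j\<in>insert i I. \<bar>(c(i := t)) j - v j\<bar> < r"
    using c(2) t(1) by auto
  ultimately show ?case
    by blast
qed auto

lemma finite_inj_on_gap:
  fixes c :: "'i \<Rightarrow> real"
  assumes "finite I" "inj_on c I"
  obtains \<delta> where "0 < \<delta>" "\<And>i j. i \<in> I \<Longrightarrow> j \<in> I \<Longrightarrow> \<bar>c i - c j\<bar> < \<delta> \<Longrightarrow> i = j"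
proof -
  \<comment> \<open>The element 1 keeps \<open>D\<close> nonempty when \<open>I\<close> has at most
    one element.\<close>
  define D where "D = insert 1 ((\<lambda>(i, j). \<bar>c i - c j\<bar>) ` {(i, j) \<in> I \<times> I. i \<noteq> j})"
  have "finite {(i, j) \<in> I \<times> I. i \<noteq> j}"
    using assms(1) by (rule finite_subset[OF _ finite_cartesian_product, rotated]) (use assms in auto)
  then have fin: "finite D" "D \<noteq> {}"
    by (auto simp: D_def)
  have "0 < d" if "d \<in> D" for d
    using that assms(2) by (auto simp: D_def inj_on_def)
  with fin have "0 < Min D"
    by simp
  moreover have "i = j" if "i \<in> I" "j \<in> I" "\<bar>c i - c j\<bar> < Min D" for i j
  proof (rule ccontr)
    assume "i \<noteq> j"
    with that have "\<bar>c i - c j\<bar> \<in> D"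
      by (auto simp: D_def)
    with fin that(3) show False
      by (meson Min_le not_less)
  qed
  ultimately show ?thesis
    using that by blast
qed

text \<open>
  Away from a small neighbourhood \<open>W\<close> of finitely many null boundaries, \<open>K\<close> splits into finitely
  many clopen cells of small diameter. The perturbation takes distinct constant values on the cells,
  so each fibre of a nearby function is contained in the union of \<open>W\<close> and a single cell.
\<close>
lemma small_fibres_perturbation:
  fixes K :: "'a::metric_space set" and f :: "'a \<Rightarrow> real"
  assumes "compact K" "top_hausdorff_dim K < ereal (s + 1)" "0 < s" "0 < e"
    and f: "continuous_on K f" and "0 < r"
  shows "\<exists>g. continuous_on K g \<and> (\<forall>x\<in>K. \<bar>g x - f x\<bar> \<le> r) \<and>
    (\<exists>\<delta>>0. \<forall>h. continuous_on K h \<longrightarrow> (\<forall>x\<in>K. \<bar>h x - g x\<bar> < \<delta>) \<longrightarrow>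
      (\<forall>y. hausdorff_content s {x \<in> K. h x = y} \<le> ennreal e))"
proof -
  let ?X = "top_of_set K"

  \<comment> \<open>A fine cover with null boundaries\<close>
  obtain \<eta> where \<eta>: "0 < \<eta>" "\<And>x z. x \<in> K \<Longrightarrow> z \<in> K \<Longrightarrow> dist z x < \<eta> \<Longrightarrow> dist (f z) (f x) < r / 2"
    using compact_uniformly_continuous[OF f \<open>compact K\<close>] \<open>0 < r\<close> half_gt_zero
    unfolding uniformly_continuous_on_def by metis
  \<comment> \<open>Sets in a ball of radius \<open>\<rho>\<close> have diameter at most
    \<open>2 * \<rho>\<close>, so they cost at most \<open>e / 2\<close>; the other half of
    \<open>e\<close> is reserved for \<open>W\<close>. The bound by \<open>\<eta>\<close> keeps
    \<open>f\<close> within \<open>r / 2\<close> of its value at the centre.\<close>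
  define \<rho> where "\<rho> = min \<eta> ((e / 2) powr (1 / s) / 2)"
  have \<rho>: "0 < \<rho>" "\<rho> \<le> \<eta>" "(2 * \<rho>) powr s \<le> e / 2"
  proof -
    show "0 < \<rho>"
      using \<eta>(1) \<open>0 < e\<close> by (simp add: \<rho>_def)
    have "(2 * \<rho>) powr s \<le> ((e / 2) powr (1 / s)) powr s"
      using \<open>0 < \<rho>\<close> \<open>0 < s\<close> by (intro powr_mono2) (auto simp: \<rho>_def)
    also have "\<dots> = e / 2"
      using \<open>0 < s\<close> \<open>0 < e\<close> by (simp add: powr_powr)
    finally show "(2 * \<rho>) powr s \<le> e / 2" .
  qed (simp add: \<rho>_def)
  have "\<exists>T. open T \<and> x \<in> T \<and> K \<inter> T \<subseteq> ball x \<rho> \<and> hausdorff_content s (?X frontier_of (K \<inter> T)) = 0"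
    if "x \<in> K" for x
    by (rule null_frontier_nbhd[OF assms(2,3) open_ball that]) (simp add: \<rho>(1))
  then obtain T where T: "\<And>x. x \<in> K \<Longrightarrow> open (T x)" "\<And>x. x \<in> K \<Longrightarrow> x \<in> T x"
      "\<And>x. x \<in> K \<Longrightarrow> K \<inter> T x \<subseteq> ball x \<rho>"
      "\<And>x. x \<in> K \<Longrightarrow> hausdorff_content s (?X frontier_of (K \<inter> T x)) = 0"
    by metis
  obtain D where D: "D \<subseteq> K" "finite D" "K \<subseteq> (\<Union>x\<in>D. T x)"
    by (rule compactE_image[OF \<open>compact K\<close>, of K T]) (use T in auto)
  \<comment> \<open>An ordering of the cover is needed to make it disjoint by removing earlier
    members.\<close>
  obtain n and p :: "nat \<Rightarrow> 'a" where p: "D = p ` {..<n}"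
    using finite_imp_nat_seg_image_inj_on[OF D(2)] by (auto simp: lessThan_def)
  have pK: "p i \<in> K" if "i < n" for i
    using p D(1) that by auto
  define V where "V i = K \<inter> T (p i)" for i
  have cover: "\<exists>i<n. x \<in> V i" if "x \<in> K" for x
    using D(3) that by (auto simp: p V_def)
  have Vball: "V i \<subseteq> ball (p i) \<rho>" if "i < n" for i
    using T(3) pK that by (simp add: V_def)

  \<comment> \<open>Closed cells away from the boundaries\<close>
  define \<F> where "\<F> = (\<lambda>i. ?X frontier_of (V i)) ` {..<n}"
  have "hausdorff_content s (\<Union>\<F>) = 0"
    using T(4) pK by (intro hausdorff_content_Union_eq_0) (auto simp: \<F>_def V_def)
  then have "hausdorff_content s (\<Union>\<F>) < ennreal (e / 2)"
    using \<open>0 < e\<close> by simp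
  then obtain W where W: "open W" "\<Union>\<F> \<subseteq> W" "hausdorff_content s W < ennreal (e / 2)"
    by (rule hausdorff_content_open_superset[OF \<open>0 < s\<close>])
  define C where "C = K - W"
  have C: "closed C" "C \<subseteq> K"
    using \<open>compact K\<close> W(1) by (auto simp: C_def compact_imp_closed closed_Diff)
  define cell where "cell i = C \<inter> V i - (\<Union>j<i. V j)" for i
  have cell_closed: "closed (cell i)" if "i < n" for i
  proof -
    have "openin ?X (V i)"
      using T(1) pK that by (simp add: V_def openin_open_Int)
    then have "?X frontier_of V i = ?X closure_of V i - V i" "V i \<subseteq> ?X closure_of V i"
      using closure_of_subset[OF openin_subset]
      by (simp_all add: frontier_of_def interior_of_openin)
    moreover have "?X frontier_of V i \<subseteq> W"
      using W(2) that by (auto simp: \<F>_def)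
    \<comment> \<open>Off \<open>W\<close> there are no boundary points of \<open>V i\<close>, so on
      \<open>C\<close> the set agrees with its closure; removing open sets then keeps the cell
      closed.\<close>
    ultimately have "C \<inter> V i = C \<inter> ?X closure_of V i"
      by (auto simp: C_def)
    then have "cell i = C \<inter> ?X closure_of V i - (\<Union>j<i. T (p j))"
      using C(2) by (auto simp: cell_def V_def)
    moreover have "closed (?X closure_of V i)"
      using closedin_closure_of \<open>compact K\<close> by (metis closedin_closed_trans compact_imp_closed)
    moreover have "open (\<Union>j<i. T (p j))"
      using T(1) pK that by auto
    ultimately show ?thesis
      using C(1) by (simp add: closed_Diff closed_Int)
  qed
  have cell_unique: "(LEAST j. x \<in> V j) = i" if "x \<in> cell i" for x i
    using that by (intro Least_equality) (auto simp: cell_def not_less[symmetric])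
  have C_cells: "C = (\<Union>i<n. cell i)"
  proof
    show "C \<subseteq> (\<Union>i<n. cell i)"
    proof
      fix x assume "x \<in> C"
      then obtain i where i: "i < n" "x \<in> V i"
        using C(2) cover by blast
      define m where "m = (LEAST j. x \<in> V j)"
      have "x \<in> V m" "m < n"
        unfolding m_def using LeastI[of "\<lambda>j. x \<in> V j", OF i(2)]
          Least_le[of "\<lambda>j. x \<in> V j", OF i(2)] i(1) by auto
      moreover have "x \<notin> V k" if "k < m" for k
        using that unfolding m_def by (rule not_less_Least)
      ultimately have "x \<in> cell m"
        using \<open>x \<in> C\<close> by (simp add: cell_def)
      with \<open>m < n\<close> show "x \<in> (\<Union>i<n. cell i)"
        by blast
    qed
  qed (auto simp: cell_def)

  \<comment> \<open>Construction of the perturbation\<close>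
  obtain c where c: "inj_on c {..<n}" "\<And>i. i < n \<Longrightarrow> \<bar>c i - f (p i)\<bar> < r / 2"
    using finite_distinct_approximations[of "{..<n}" "r / 2" "\<lambda>i. f (p i)"] \<open>0 < r\<close> by auto
  obtain \<delta> where \<delta>: "0 < \<delta>" "\<And>i j. i < n \<Longrightarrow> j < n \<Longrightarrow> \<bar>c i - c j\<bar> < \<delta> \<Longrightarrow> i = j"
    using finite_inj_on_gap[OF _ c(1)] by (metis finite_lessThan lessThan_iff)
  \<comment> \<open>This is the correction that makes \<open>f\<close> equal to \<open>c i\<close>
    on cell \<open>i\<close>. Extending the correction by Tietze with values in
    \<open>{-r..r}\<close>, rather than extending the new function itself, bounds the perturbation
    by \<open>r\<close> on all of \<open>K\<close>.\<close>
  define u where "u x = c (LEAST j. x \<in> V j) - f x" for x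
  have "continuous_on (cell i) u" for i
  proof -
    have "cell i \<subseteq> K"
      using C(2) by (auto simp: cell_def)
    then have "continuous_on (cell i) (\<lambda>x. c i - f x)"
      by (intro continuous_intros continuous_on_subset[OF f])
    then show ?thesis
      by (rule continuous_on_eq) (simp add: u_def cell_unique)
  qed
  then have "continuous_on C u"
    unfolding C_cells using cell_closed by (intro continuous_on_closed_Union) auto
  moreover have "subtopology ?X C = top_of_set C"
    using C(2) by (simp add: subtopology_subtopology inf_absorb2)
  ultimately have u: "continuous_map (subtopology ?X C) euclideanreal u"
    by simp
  have "u x \<in> {-r..r}" if xC: "x \<in> C" for x
  proof -
    obtain i where i: "i < n" "x \<in> cell i"
      using xC C_cells by blast
    have "dist x (p i) < \<eta>"
      using Vball[OF i(1)] i(2) \<rho>(2) by (auto simp: cell_def dist_commute)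
    then have "dist (f x) (f (p i)) < r / 2"
      using \<eta>(2)[OF pK[OF i(1)]] that C(2) by blast
    moreover have "u x = c i - f x"
      by (simp add: u_def cell_unique[OF i(2)])
    ultimately have "\<bar>u x\<bar> \<le> r"
      using c(2)[OF i(1)] unfolding dist_real_def by linarith
    then show ?thesis
      by (simp add: abs_le_iff)
  qed
  then have "u ` C \<subseteq> {-r..r}"
    by blast
  moreover have "closedin ?X C"
    using C by (intro closed_subset)
  moreover have "is_interval {-r..r}" "{-r..r} \<noteq> {}"
    using \<open>0 < r\<close> by auto
  ultimately obtain w where w: "continuous_map ?X euclideanreal w" "w ` topspace ?X \<subseteq> {-r..r}"
      "\<And>x. x \<in> C \<Longrightarrow> w x = u x"
    using Tietze_extension_realinterval[OF normal_space_top_of_set _ _ _ u] by metis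
  define g where "g x = f x + w x" for x
  have "continuous_on K g"
    unfolding g_def using f w(1) by (intro continuous_intros) auto
  moreover have "\<bar>g x - f x\<bar> \<le> r" if "x \<in> K" for x
    using w(2) that by (auto simp: g_def abs_le_iff image_subset_iff)

  \<comment> \<open>Content of the fibres of nearby functions\<close>
  moreover have "hausdorff_content s {x \<in> K. h x = y} \<le> ennreal e"
    if h: "\<And>x. x \<in> K \<Longrightarrow> \<bar>h x - g x\<bar> < \<delta> / 2" for h y
  proof -
    have near: "\<bar>y - c i\<bar> < \<delta> / 2" if "x \<in> cell i" "h x = y" for x i
    proof -
      have "x \<in> C"
        using that(1) by (simp add: cell_def)
      then have "g x = c i"
        using w(3) cell_unique[OF that(1)] by (simp add: g_def u_def)
      then show ?thesis
        using h[of x] that(2) \<open>x \<in> C\<close> C(2) by auto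
    qed
    have "\<exists>i. {x \<in> K. h x = y} - W \<subseteq> cell i \<and> i < n \<or> {x \<in> K. h x = y} - W = {}"
    proof (cases "{x \<in> K. h x = y} - W = {}")
      case False
      then obtain x where x: "x \<in> C" "h x = y"
        by (auto simp: C_def)
      then obtain i where i: "i < n" "x \<in> cell i"
        using C_cells by blast
      have "z \<in> cell i" if "z \<in> {x \<in> K. h x = y} - W" for z
      proof -
        have "z \<in> C" "h z = y"
          using that by (auto simp: C_def)
        then obtain j where j: "j < n" "z \<in> cell j"
          using C_cells by blast
        have "\<bar>c i - c j\<bar> < \<delta>"
          using near[OF i(2) x(2)] near[OF j(2) \<open>h z = y\<close>] by linarith
        then show ?thesis
          using \<delta>(2) i(1) j by blast
      qed
      with i(1) show ?thesis
        by blast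
    qed auto
    then obtain A where A: "{x \<in> K. h x = y} \<subseteq> W \<union> A" "A = {} \<or> (\<exists>i<n. A \<subseteq> V i)"
      unfolding cell_def by blast
    have "diam_pow s A \<le> ennreal (e / 2) \<and> bounded A"
    proof (cases "A = {}")
      case False
      then obtain i where i: "i < n" "A \<subseteq> ball (p i) \<rho>"
        using A(2) Vball by blast
      have "bounded A"
        using i(2) bounded_ball bounded_subset by blast
      have "dist a b \<le> 2 * \<rho>" if "a \<in> A" "b \<in> A" for a b
      proof -
        have "dist (p i) a < \<rho>" "dist (p i) b < \<rho>"
          using i(2) that by auto
        then show ?thesis
          using dist_triangle3[of a b "p i"] by linarith
      qed
      then have "diameter A \<le> 2 * \<rho>"
        unfolding diameter_def using False by (auto intro!: cSUP_least)
      then have "diameter A powr s \<le> (2 * \<rho>) powr s"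
        using diameter_ge_0[OF \<open>bounded A\<close>] \<open>0 < s\<close> by (intro powr_mono2) auto
      then have "diam_pow s A \<le> ennreal (e / 2)"
        using \<rho>(3) \<open>0 < s\<close> False by (auto simp: diam_pow_def intro!: ennreal_leI)
      with \<open>bounded A\<close> show ?thesis
        by blast
    qed auto
    then have "hausdorff_content s A \<le> ennreal (e / 2)"
      using hausdorff_content_le_diam_pow order_trans by blast
    with W(3) have "hausdorff_content s W + hausdorff_content s A \<le> ennreal (e / 2) + ennreal (e / 2)"
      by (intro add_mono) auto
    also have "\<dots> = ennreal e"
      using \<open>0 < e\<close> by (simp flip: ennreal_plus)
    finally show ?thesis
      using hausdorff_content_mono[OF A(1)] hausdorff_content_Un order_trans by metis
  qed
  ultimately show ?thesis
    using \<delta>(1) by (intro exI[of _ g] conjI exI[of _ "\<delta> / 2"]) auto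
qed

theorem corollary7p14:
  fixes K :: "'a::metric_space set"
  assumes "compact K"
    and "top_dim (top_of_set K) > 0"
  shows "generic_in_C K
    (\<lambda>f. (SUP y::real. hausdorff_dim {x \<in> K. f x = y}) = top_hausdorff_dim K - 1)"
proof -
  let ?T = "top_hausdorff_dim K"
  have "K \<noteq> {}"
    using assms(2) top_dim_rec[of "top_of_set K"] by (auto split: if_splits)
  then have T: "1 \<le> ?T"
    using one_le_top_hausdorff_dim assms(2) by blast
  have T1: "?T < ereal (q + 1) \<longleftrightarrow> ?T - 1 < ereal q" "ereal (q + 1) < ?T \<longleftrightarrow> ereal q < ?T - 1" for q
    using T by (cases ?T; force simp: one_ereal_def)+
  \<comment> \<open>The left summand controls all fibres at exponents above \<open>?T - 1\<close>,
    the right one asks for a large fibre at each level below it. Rational parameters keep the index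
    type countable; the guards make irrelevant indices vacuous, in particular the whole left family
    when \<open>?T = \<infinity>\<close>.\<close>
  define Q where "Q = case_sum
    (\<lambda>(q :: rat, n :: nat) (f :: 'a \<Rightarrow> real). 0 < q \<and> ?T < ereal (real_of_rat q + 1) \<longrightarrow>
      (\<forall>y. hausdorff_content (real_of_rat q) {x \<in> K. f x = y} \<le> ennreal (1 / real (Suc n))))
    (\<lambda>(q :: rat) f. ereal (real_of_rat q + 1) < ?T \<longrightarrow>
      (\<exists>y. ereal (real_of_rat q) < hausdorff_dim {x \<in> K. f x = y}))"
  show ?thesis
  proof (rule generic_in_CI[OF assms(1), where Q = Q])
    fix i :: "rat \<times> nat + rat" and f :: "'a \<Rightarrow> real" and r :: real
    assume f: "continuous_on K f" and "0 < r"
    show "\<exists>g. continuous_on K g \<and> (\<forall>x\<in>K. \<bar>g x - f x\<bar> \<le> r) \<and>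
        (\<exists>\<delta>>0. \<forall>h. continuous_on K h \<longrightarrow> (\<forall>x\<in>K. \<bar>h x - g x\<bar> < \<delta>) \<longrightarrow> Q i h)"
    proof (cases i)
      case (Inl p)
      obtain q n where i: "i = Inl (q, n)"
        using Inl by (cases p) auto
      show ?thesis
      proof (cases "0 < q \<and> ?T < ereal (real_of_rat q + 1)")
        case True
        then show ?thesis
          using small_fibres_perturbation[OF assms(1) _ _ _ f \<open>0 < r\<close>, of "real_of_rat q" "1 / real (Suc n)"]
          by (simp add: Q_def i)
      next
        case False
        then show ?thesis
          using f \<open>0 < r\<close> by (intro exI[of _ f] conjI exI[of _ 1]) (auto simp: Q_def i)
      qed
    next
      case (Inr q)
      show ?thesis
      proof (cases "ereal (real_of_rat q + 1) < ?T")
        case True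
        then show ?thesis
          using large_fibre_perturbation[OF True \<open>K \<noteq> {}\<close> f \<open>0 < r\<close>]
          by (simp add: Q_def Inr)
      next
        case False
        then show ?thesis
          using f \<open>0 < r\<close> by (intro exI[of _ f] conjI exI[of _ 1]) (auto simp: Q_def Inr)
      qed
    qed
  next
    fix f :: "'a \<Rightarrow> real"
    assume Q: "\<And>i. Q i f"
    let ?S = "SUP y. hausdorff_dim {x \<in> K. f x = y}"
    show "?S = ?T - 1"
    proof (rule antisym; rule ccontr)
      assume "\<not> ?S \<le> ?T - 1"
      then obtain q where q: "?T - 1 < ereal (real_of_rat q)" "ereal (real_of_rat q) < ?S"
        using ereal_dense3[of "?T - 1" ?S] by (auto simp: not_le)
      \<comment> \<open>Positive topological dimension enters here: it gives
        \<open>1 \<le> ?T\<close>, hence \<open>0 < q\<close>, as the passage from null content to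
        dimension requires.\<close>
      have "0 \<le> ?T - 1"
        using T by (cases ?T) (auto simp: one_ereal_def)
      with q(1) have "0 < q"
        by (metis ereal_less(2) le_less_trans zero_less_of_rat_iff)
      have "hausdorff_dim {x \<in> K. f x = y} \<le> ereal (real_of_rat q)" for y
      proof (rule hausdorff_dim_le_if_content)
        \<comment> \<open>The conditions for all \<open>n\<close> at this fixed \<open>q\<close>
          squeeze the content to 0.\<close>
        have "hausdorff_content (real_of_rat q) {x \<in> K. f x = y} \<le> 0 + ennreal e" if e: "0 < e" for e
        proof -
          obtain n where "1 / real (Suc n) < e"
            using nat_approx_posE[OF e] by blast
          then have "ennreal (1 / real (Suc n)) \<le> ennreal e"
            by (intro ennreal_leI) simp
          moreover have "hausdorff_content (real_of_rat q) {x \<in> K. f x = y} \<le> ennreal (1 / real (Suc n))"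
            using Q[of "Inl (q, n)"] q(1) \<open>0 < q\<close> by (simp add: Q_def T1(1))
          ultimately show ?thesis
            by simp
        qed
        then have "hausdorff_content (real_of_rat q) {x \<in> K. f x = y} \<le> 0"
          by (rule ennreal_le_epsilon)
        then show "hausdorff_content (real_of_rat q) {x \<in> K. f x = y} = 0"
          by simp
      qed (use \<open>0 < q\<close> in simp)
      then have "?S \<le> ereal (real_of_rat q)"
        by (rule SUP_least)
      with q(2) show False
        by simp
    next
      assume "\<not> ?T - 1 \<le> ?S"
      then obtain q where q: "?S < ereal (real_of_rat q)" "ereal (real_of_rat q) < ?T - 1"
        using ereal_dense3[of ?S "?T - 1"] by (auto simp: not_le)
      then obtain y where "ereal (real_of_rat q) < hausdorff_dim {x \<in> K. f x = y}"
        using Q[of "Inr q"] by (auto simp: Q_def T1(2))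
      also have "\<dots> \<le> ?S"
        by (rule SUP_upper) simp
      finally show False
        using q(1) by simp
    qed
  qed
qed

end
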